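(* Let $H=H(n,r,q\mid\sigma)$ be a $\sigma$-hypergraph, where $\sigma$ is a partition of $r$ with $s=s(\sigma)\ge 2$ parts, and let $k$ be an integer with $2\le k\le s$. If $q\ge r(r-1)$ and $n\ge s+1$, then $H$ has a $k$-intersecting Hamiltonian cycle.
   Context: Let $\sigma=(a_1,\ldots,a_s)$ be a partition of the positive integer $r$ into $s=s(\sigma)$ positive parts, with largest part $\Delta$. The $\sigma$-hypergraph $H(n,r,q\mid\sigma)$ is the $r$-uniform hypergraph whose $nq$ vertices are partitioned into $n$ classes $V_1,\ldots,V_n$ of $q$ vertices each, and in which an $r$-subset $K$ of the vertices is an edge if and only if the multiset of non-zero cardinalities $|K\cap V_i|$, $1\le i\le n$, is the partition $\sigma$ of $r$. It is always assumed that $q\ge\Delta$ and $n\ge s$. A sequence $C=(e_1,\ldots,e_p)$ of edges of a hypergraph $H$ is a $k$-intersecting cycle if $|e_i\cap e_{i+1}\cap\cdots\cap e_{i+k-1}|>0$ for $1\le i\le p$, with indices modulo $p$, while any other collection of $k$ or more edges of $C$ (that is, any collection that is not a set of $k$ cyclically consecutive edges) has empty intersection. Write $V(C)=e_1\cup\cdots\cup e_p$. If $V(C)=V(H)$, then $C$ is a $k$-intersecting Hamiltonian cycle. *)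

theory Defs
  imports "HOL-Library.Multiset" "HOL-Library.Disjoint_Sets"
begin

record 'a hypergraph =
  verts :: "'a set"
  edges :: "'a set set"

definition partition_of :: "nat \<Rightarrow> nat multiset \<Rightarrow> bool" where
  "partition_of r \<sigma> \<longleftrightarrow> 0 < r \<and> (\<forall>a \<in># \<sigma>. 0 < a) \<and> sum_mset \<sigma> = r"

definition intersection_pattern :: "nat \<Rightarrow> (nat \<Rightarrow> 'a set) \<Rightarrow> 'a set \<Rightarrow> nat multiset" where
  "intersection_pattern n V K =
     filter_mset (\<lambda>m. m \<noteq> 0) (image_mset (\<lambda>i. card (K \<inter> V i)) (mset_set {..<n}))"

text \<open>
  \<open>sigma_hypergraph n r q \<sigma> H\<close> says that \<open>H\<close> is (a copy of) \<open>H(n,r,q|\<sigma>)\<close>, with classes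
  \<open>V 0, \<dots>, V (n - 1)\<close>. It includes the standing assumptions that \<open>q\<close> is at least the largest
  part of \<open>\<sigma>\<close> and \<open>n\<close> at least the number of parts.
\<close>
definition sigma_hypergraph ::
    "nat \<Rightarrow> nat \<Rightarrow> nat \<Rightarrow> nat multiset \<Rightarrow> 'a hypergraph \<Rightarrow> bool" where
  "sigma_hypergraph n r q \<sigma> H \<longleftrightarrow>
     partition_of r \<sigma> \<and> Max (set_mset \<sigma>) \<le> q \<and> size \<sigma> \<le> n \<and>
     (\<exists>V :: nat \<Rightarrow> 'a set.
        (\<forall>i<n. finite (V i) \<and> card (V i) = q) \<and>
        disjoint_family_on V {..<n} \<and>
        verts H = (\<Union>i<n. V i) \<and>
        edges H = {K. K \<subseteq> verts H \<and> card K = r \<and> intersection_pattern n V K = \<sigma>})"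

definition cyclic_window :: "nat \<Rightarrow> nat \<Rightarrow> nat \<Rightarrow> nat set" where
  "cyclic_window p k i = (\<lambda>j. (i + j) mod p) ` {..<k}"

text \<open>
  Edges are indexed from 0, and a collection of edges of the sequence is given by its set \<open>J\<close> of
  positions, so that repeated edges would count separately; for \<open>2 \<le> k < length C\<close> the last
  condition therefore forces the edges of \<open>C\<close> to be distinct. The condition \<open>k \<le> length C\<close>,
  implicit in speaking of \<open>k\<close> cyclically consecutive edges, excludes degenerate sequences.
\<close>
definition intersecting_cycle :: "'a hypergraph \<Rightarrow> nat \<Rightarrow> 'a set list \<Rightarrow> bool" where
  "intersecting_cycle H k C \<longleftrightarrow>
     set C \<subseteq> edges H \<and> k \<le> length C \<and>
     (\<forall>i<length C. 0 < card (\<Inter>j\<in>cyclic_window (length C) k i. C ! j)) \<and>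
     (\<forall>J. J \<subseteq> {..<length C} \<and> k \<le> card J \<and> (\<forall>i<length C. J \<noteq> cyclic_window (length C) k i)
        \<longrightarrow> (\<Inter>j\<in>J. C ! j) = {})"

definition intersecting_hamiltonian_cycle :: "'a hypergraph \<Rightarrow> nat \<Rightarrow> 'a set list \<Rightarrow> bool" where
  "intersecting_hamiltonian_cycle H k C \<longleftrightarrow>
     intersecting_cycle H k C \<and> \<Union> (set C) = verts H"

end

(*
  Take p = n * m edges. Each window of k consecutive edges gets a private vertex, a link, the links
  running cyclically through the classes; every edge then consists of k links from k consecutive
  classes and of r - k fillers. With all fillers of degree one, every class uses exactly
  m * (r - k + 1) vertices. For m the rounded up quotient of q by r - k + 1 this exceeds q by some
  D <= r - k, and D vertices per class are saved by letting consecutive edges share fillers, which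
  is always allowed because a vertex in two consecutive edges has degree < k or spans a window of
  size k = 2. If all parts of sigma are at least 2, there are fillers of a common class in every
  two consecutive edges. Otherwise a part equal to 1 together with an unused class (n > s) makes it
  possible to give two consecutive edges fillers in exactly the same classes. The bound
  q >= r * (r - 1) ensures m >= r, which leaves room for the sharing.
*)
theory Submission
  imports Defs
begin

section \<open>From incidence data to a Hamiltonian cycle\<close>

lemma cyclic_window_subset: "0 < p \<Longrightarrow> cyclic_window p k i \<subseteq> {..<p}"
  by (auto simp: cyclic_window_def)

lemma card_cyclic_window_le: "card (cyclic_window p k i) \<le> k"
  unfolding cyclic_window_def using card_image_le[of "{..<k}"] by simp

lemma sum_mset_filter_nonzero: "sum_mset (filter_mset (\<lambda>m. m \<noteq> 0) M) = sum_mset M"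
  for M :: "nat multiset"
  by (induction M) auto

text \<open>
  \<open>U\<close> is an abstract copy of the vertex set, \<open>cl u\<close> the class of \<open>u\<close> and \<open>J u\<close> the set of
  positions of the edges containing \<open>u\<close>.
\<close>
lemma hamiltonian_cycle_from_incidence:
  fixes H :: "'a hypergraph" and U :: "'u set" and cl :: "'u \<Rightarrow> nat" and J :: "'u \<Rightarrow> nat set"
  assumes H: "sigma_hypergraph n r q \<sigma> H"
    and U: "finite U" "\<And>u. u \<in> U \<Longrightarrow> cl u < n"
    and cards: "\<And>c. c < n \<Longrightarrow> card {u \<in> U. cl u = c} = q"
    and J: "\<And>u. u \<in> U \<Longrightarrow> J u \<noteq> {}" "\<And>u. u \<in> U \<Longrightarrow> J u \<subseteq> {..<p}"
    and small: "\<And>u. u \<in> U \<Longrightarrow> card (J u) < k \<or> (\<exists>i<p. J u = cyclic_window p k i)"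
    and windows: "\<And>i. i < p \<Longrightarrow> \<exists>u\<in>U. J u = cyclic_window p k i"
    and pattern: "\<And>i. i < p \<Longrightarrow>
        filter_mset (\<lambda>m. m \<noteq> 0)
          (image_mset (\<lambda>c. card {u \<in> U. cl u = c \<and> i \<in> J u}) (mset_set {..<n})) = \<sigma>"
    and k: "0 < k" "k \<le> p"
  shows "\<exists>C. intersecting_hamiltonian_cycle H k C"
proof -
  obtain V :: "nat \<Rightarrow> 'a set" where
    V: "\<And>i. i < n \<Longrightarrow> finite (V i)" "\<And>i. i < n \<Longrightarrow> card (V i) = q"
    and disj: "disjoint_family_on V {..<n}"
    and vH: "verts H = (\<Union>i<n. V i)"
    and eH: "edges H = {K. K \<subseteq> verts H \<and> card K = r \<and> intersection_pattern n V K = \<sigma>}"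
    and sr: "sum_mset \<sigma> = r"
    using H unfolding sigma_hypergraph_def partition_of_def by blast
  have "\<exists>g. bij_betw g {u \<in> U. cl u = c} (V c)" if "c < n" for c
    using that U V cards by (intro finite_same_card_bij) auto
  then obtain g where g: "\<And>c. c < n \<Longrightarrow> bij_betw (g c) {u \<in> U. cl u = c} (V c)"
    by metis
  define \<phi> where "\<phi> u = g (cl u) u" for u
  have \<phi>V: "\<phi> u \<in> V (cl u)" if "u \<in> U" for u
    using g[OF U(2)[OF that]] that unfolding \<phi>_def bij_betw_def by auto
  have class_eq: "c = d" if "x \<in> V c" "x \<in> V d" "c < n" "d < n" for x c d
    using disj that unfolding disjoint_family_on_def by blast
  have inj: "inj_on \<phi> U"
  proof (rule inj_onI)
    fix u v assume uv: "u \<in> U" "v \<in> U" "\<phi> u = \<phi> v"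
    have "cl u = cl v"
      using class_eq[of "\<phi> u" "cl u" "cl v"] \<phi>V uv U(2) by metis
    moreover have "inj_on (g (cl u)) {w \<in> U. cl w = cl u}"
      using g[OF U(2)[OF uv(1)]] by (simp add: bij_betw_def)
    ultimately show "u = v"
      using uv unfolding \<phi>_def by (auto dest: inj_onD)
  qed
  have surj: "verts H \<subseteq> \<phi> ` U"
  proof
    fix x assume "x \<in> verts H"
    then obtain c where c: "c < n" "x \<in> V c" using vH by auto
    then obtain u where "u \<in> U" "cl u = c" "x = g c u"
      using g[OF c(1)] unfolding bij_betw_def by blast
    then show "x \<in> \<phi> ` U" by (auto simp: \<phi>_def)
  qed
  have sub: "\<phi> ` U \<subseteq> verts H"
    using \<phi>V U(2) vH by blast
  define e where "e i = \<phi> ` {u \<in> U. i \<in> J u}" for i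
  have finV: "finite (verts H)" using vH V by auto
  have eV: "e i \<subseteq> verts H" for i using sub by (auto simp: e_def)
  have eVc: "card (e i \<inter> V c) = card {u \<in> U. cl u = c \<and> i \<in> J u}" if c: "c < n" for i c
  proof -
    have "e i \<inter> V c = \<phi> ` {u \<in> U. cl u = c \<and> i \<in> J u}"
      using class_eq[of _ _ c] \<phi>V U(2) c unfolding e_def by blast
    moreover have "inj_on \<phi> {u \<in> U. cl u = c \<and> i \<in> J u}"
      using inj by (rule inj_on_subset) auto
    ultimately show ?thesis by (simp add: card_image)
  qed
  have pat: "intersection_pattern n V (e i) = \<sigma>" if "i < p" for i
  proof -
    have "image_mset (\<lambda>c. card (e i \<inter> V c)) (mset_set {..<n})
        = image_mset (\<lambda>c. card {u \<in> U. cl u = c \<and> i \<in> J u}) (mset_set {..<n})"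
      by (rule image_mset_cong) (simp add: eVc)
    then show ?thesis
      unfolding intersection_pattern_def using pattern[OF that] by simp
  qed
  have cardr: "card (e i) = r" if "i < p" for i
  proof -
    have "e i = (\<Union>c<n. e i \<inter> V c)" using eV[of i] vH by auto
    also have "card \<dots> = (\<Sum>c<n. card (e i \<inter> V c))"
      using disj V by (intro card_UN_disjoint) (auto simp: disjoint_family_on_def)
    also have "\<dots> = sum_mset (intersection_pattern n V (e i))"
      unfolding intersection_pattern_def sum_mset_filter_nonzero by (simp add: sum_unfold_sum_mset)
    finally show ?thesis using pat[OF that] sr by simp
  qed
  define C where "C = map e [0..<p]"
  have len: "length C = p" and nth: "\<And>i. i < p \<Longrightarrow> C ! i = e i" and setC: "set C = e ` {..<p}"
    by (auto simp: C_def)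
  have "set C \<subseteq> edges H"
    using setC eH eV pat cardr by fastforce
  moreover have "0 < card (\<Inter>j\<in>cyclic_window p k i. C ! j)" if i: "i < p" for i
  proof -
    obtain u where u: "u \<in> U" "J u = cyclic_window p k i" using windows[OF i] by blast
    have W: "cyclic_window p k i \<subseteq> {..<p}" using i by (intro cyclic_window_subset) simp
    have "\<phi> u \<in> (\<Inter>j\<in>cyclic_window p k i. C ! j)"
      using u W nth by (auto simp: e_def)
    moreover have "finite (\<Inter>j\<in>cyclic_window p k i. C ! j)"
    proof -
      obtain j where j: "j \<in> cyclic_window p k i" using u J(1) by blast
      then have "C ! j \<subseteq> verts H" using W nth[of j] eV[of j] by auto
      then show ?thesis using j finV by (meson INT_lower finite_subset)
    qed
    ultimately show ?thesis by (metis card_gt_0_iff empty_iff)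
  qed
  moreover have "(\<Inter>j\<in>I. C ! j) = {}"
    if I: "I \<subseteq> {..<p}" "k \<le> card I" "\<forall>i<p. I \<noteq> cyclic_window p k i" for I
  proof (rule ccontr)
    assume "(\<Inter>j\<in>I. C ! j) \<noteq> {}"
    then obtain x where x: "\<And>j. j \<in> I \<Longrightarrow> x \<in> e j" using I(1) nth by fastforce
    obtain j0 where j0: "j0 \<in> I" using I(2) k(1) by fastforce
    obtain u where u: "u \<in> U" "x = \<phi> u" using x[OF j0] by (auto simp: e_def)
    \<comment> \<open>Injectivity of \<open>\<phi>\<close> forces a common vertex of the edges in
      \<open>I\<close> to come from one \<open>u\<close> with \<open>I \<subseteq> J u\<close>. As
      \<open>k \<le> card I\<close>, this \<open>J u\<close> must be a window, hence has at most
      \<open>k\<close> elements and equals \<open>I\<close>.\<close>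
    have IJ: "I \<subseteq> J u"
    proof
      fix j assume "j \<in> I"
      then obtain v where "v \<in> U" "j \<in> J v" "\<phi> v = x" using x by (auto simp: e_def)
      then show "j \<in> J u" using u inj by (auto dest: inj_onD)
    qed
    have fJ: "finite (J u)" using J(2)[OF u(1)] finite_subset by blast
    have "k \<le> card (J u)" using IJ fJ I(2) card_mono le_trans by blast
    then obtain i where i: "i < p" "J u = cyclic_window p k i" using small[OF u(1)] by auto
    have "card (J u) \<le> card I" using i(2) card_cyclic_window_le[of p k i] I(2) by simp
    then have "I = J u" using IJ fJ card_seteq by blast
    then show False using i I(3) by blast
  qed
  moreover have "\<Union> (set C) = verts H"
  proof
    show "\<Union> (set C) \<subseteq> verts H" using setC eV by auto
    show "verts H \<subseteq> \<Union> (set C)"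
    proof
      fix x assume "x \<in> verts H"
      then obtain u where u: "u \<in> U" "x = \<phi> u" using surj by blast
      then obtain i where "i \<in> J u" "i < p" using J by blast
      then show "x \<in> \<Union> (set C)" using u setC by (auto simp: e_def)
    qed
  qed
  ultimately have "intersecting_hamiltonian_cycle H k C"
    unfolding intersecting_hamiltonian_cycle_def intersecting_cycle_def len
    using k by blast
  then show ?thesis by blast
qed

section \<open>Periodic sums and rotation of the classes\<close>

lemma sum_periodic:
  fixes f :: "nat \<Rightarrow> nat"
  assumes "\<And>i. f (i + n) = f i"
  shows "(\<Sum>i<n * m. f i) = m * (\<Sum>i<n. f i)"
proof -
  have per: "f (i + j * n) = f i" for i j
    using assms by (induction j) (auto simp: algebra_simps, metis add.assoc add.commute)
  have "(\<Sum>i<n * m. f i) = (\<Sum>j<m. sum f {j * n..<j * n + n})"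
    by (simp add: sum.nat_group mult.commute)
  also have "\<dots> = (\<Sum>j<m. \<Sum>i<n. f i)"
  proof (rule sum.cong[OF refl])
    fix j
    have "sum f {0 + j * n..<n + j * n} = (\<Sum>i\<in>{0..<n}. f (i + j * n))"
      by (rule sum.shift_bounds_nat_ivl)
    then show "sum f {j * n..<j * n + n} = (\<Sum>i<n. f i)"
      by (simp add: per add.commute lessThan_atLeast0)
  qed
  finally show ?thesis by simp
qed

text \<open>
  The residue of \<open>c - i\<close> modulo \<open>n\<close>, with \<open>i\<close> reduced first so that the subtraction of naturals
  does not truncate.
\<close>
definition offset :: "nat \<Rightarrow> nat \<Rightarrow> nat \<Rightarrow> nat" where
  "offset n i c = (c + (n - i mod n)) mod n"

lemma offset_less: "0 < n \<Longrightarrow> offset n i c < n"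
  by (simp add: offset_def)

lemma offset_periodic: "offset n (i + n) c = offset n i c"
  by (simp add: offset_def)

lemma add_offset_mod: "c < n \<Longrightarrow> (i + offset n i c) mod n = c"
proof -
  assume c: "c < n"
  have "(i + offset n i c) mod n = (i mod n + (c + (n - i mod n))) mod n"
    unfolding offset_def by (simp add: mod_simps)
  also have "i mod n + (c + (n - i mod n)) = c + n"
    using c mod_less_divisor[of n i] by linarith
  finally show ?thesis using c by simp
qed

lemma mod_add_left_inj:
  fixes n :: nat
  assumes "(i + d) mod n = (i + d') mod n" "d < n" "d' < n"
  shows "d = d'"
proof -
  have "d = d'" if "(i + d) mod n = (i + d') mod n" "d \<le> d'" "d' < n" for d d'
  proof -
    have "n dvd (i + d') - (i + d)" using that mod_eq_dvd_iff_nat[of "i + d" "i + d'" n] by simp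
    then show ?thesis using that by (auto dest: dvd_imp_le)
  qed
  then show ?thesis using assms by (metis nat_le_linear)
qed

lemma offset_eqI:
  assumes "d < n" "(i + d) mod n = c"
  shows "offset n i c = d"
proof -
  have c: "c < n" using assms by auto
  show ?thesis
    using mod_add_left_inj[of i "offset n i c" n d] add_offset_mod[OF c] assms offset_less[of n i c]
    by simp
qed

lemma bij_offset_class: "0 < n \<Longrightarrow> bij_betw (offset n i) {..<n} {..<n}"
  by (rule bij_betw_byWitness[where f' = "\<lambda>d. (i + d) mod n"])
     (auto simp: add_offset_mod offset_less intro: offset_eqI)

text \<open>Over a full period of edges a fixed class takes each role once, so a rotating
  construction uses all classes equally.\<close>

lemma bij_offset_position:
  assumes "c < n"
  shows "bij_betw (\<lambda>i. offset n i c) {..<n} {..<n}"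
proof -
  have "inj_on (\<lambda>i. offset n i c) {..<n}"
  proof (rule inj_onI)
    fix i j assume ij: "i \<in> {..<n}" "j \<in> {..<n}" "offset n i c = offset n j c"
    then show "i = j"
      using add_offset_mod[OF assms, of i] add_offset_mod[OF assms, of j]
        mod_add_left_inj[of "offset n i c" i n j] by (simp add: add.commute)
  qed
  then show ?thesis
    using assms offset_less[of n _ c] by (intro bij_betw_imageI endo_inj_surj) auto
qed

lemma sum_offset_position: "c < n \<Longrightarrow> (\<Sum>i<n. G (offset n i c)) = (\<Sum>d<n. G d)"
  by (rule sum.reindex_bij_betw[OF bij_offset_position])

text \<open>Makes the intersection pattern of a rotated edge independent of its position
  \<open>i\<close>.\<close>

lemma image_mset_offset_class:
  assumes "0 < n"
  shows "image_mset (\<lambda>c. G (offset n i c)) (mset_set {..<n}) = image_mset G (mset_set {..<n})"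
proof -
  have "image_mset (offset n i) (mset_set {..<n}) = mset_set {..<n}"
    using bij_offset_class[OF assms, of i] by (simp add: bij_betw_def image_mset_mset_set)
  then have "image_mset G (image_mset (offset n i) (mset_set {..<n})) = image_mset G (mset_set {..<n})"
    by simp
  then show ?thesis by (simp add: multiset.map_comp comp_def)
qed

section \<open>Realising links and fillers as vertices\<close>

text \<open>Modulo \<open>p\<close>, \<open>j = t - (k - 1) + a\<close> amounts to
  \<open>t = j + (k - 1 - a)\<close>. So if link \<open>t\<close> lies in the window of edges ending
  at \<open>t\<close>, edge \<open>j\<close> holds exactly the links
  \<open>j, ..., j + k - 1\<close>.\<close>

lemma cyclic_window_mem_iff:
  assumes "j < p" "t < p" "k \<le> p" "0 < k"
  shows "j \<in> cyclic_window p k ((t + p - (k - 1)) mod p) \<longleftrightarrow> (\<exists>d<k. (j + d) mod p = t)"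
proof -
  have eq: "((t + p - (k - 1)) mod p + a) mod p = j \<longleftrightarrow> (j + (k - 1 - a)) mod p = t" if a: "a < k" for a
  proof -
    have *: "((t + p - (k - 1)) mod p + a) mod p = (t + (p - (k - 1 - a))) mod p"
    proof -
      have "((t + p - (k - 1)) mod p + a) mod p = (t + p - (k - 1) + a) mod p"
        by (simp add: mod_simps)
      also have "t + p - (k - 1) + a = t + (p - (k - 1 - a))" using a assms by linarith
      finally show ?thesis .
    qed
    define b where "b = k - 1 - a"
    have b: "b < p" using assms a by (simp add: b_def)
    have "(t + (p - b)) mod p = j \<longleftrightarrow> (j + b) mod p = t"
    proof
      assume "(t + (p - b)) mod p = j"
      then have "(j + b) mod p = (t + (p - b) + b) mod p" by (metis mod_add_left_eq)
      also have "\<dots> = t" using b assms by simp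
      finally show "(j + b) mod p = t" .
    next
      assume "(j + b) mod p = t"
      then have "(t + (p - b)) mod p = (j + b + (p - b)) mod p" by (metis mod_add_left_eq)
      also have "\<dots> = j" using b assms by simp
      finally show "(t + (p - b)) mod p = j" .
    qed
    then show ?thesis using * by (simp add: b_def)
  qed
  show ?thesis
  proof
    assume "j \<in> cyclic_window p k ((t + p - (k - 1)) mod p)"
    then obtain a where "a < k" "((t + p - (k - 1)) mod p + a) mod p = j"
      by (auto simp: cyclic_window_def)
    then show "\<exists>d<k. (j + d) mod p = t" using eq by (intro exI[of _ "k - 1 - a"]) auto
  next
    assume "\<exists>d<k. (j + d) mod p = t"
    then obtain d where d: "d < k" "(j + d) mod p = t" by blast
    have a: "k - 1 - d < k" "k - 1 - (k - 1 - d) = d" using d(1) by linarith+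
    have "((t + p - (k - 1)) mod p + (k - 1 - d)) mod p = j" using eq[OF a(1)] a(2) d(2) by simp
    then show "j \<in> cyclic_window p k ((t + p - (k - 1)) mod p)"
      unfolding cyclic_window_def using a(1) by blast
  qed
qed

text \<open>The links \<open>i, ..., i + k - 1\<close> of edge \<open>i\<close> lie in distinct
  classes because \<open>k \<le> n\<close>; only \<open>d = offset n i c\<close> can reach class
  \<open>c\<close>.\<close>

lemma card_links:
  assumes "n dvd p" "0 < p" "k \<le> n" "c < n"
  shows "card {t \<in> {..<p}. t mod n = c \<and> (\<exists>d<k. (i + d) mod p = t)} = of_bool (offset n i c < k)"
proof -
  have kp: "k \<le> p" using dvd_imp_le[OF assms(1,2)] assms(3) by linarith
  have "{t \<in> {..<p}. t mod n = c \<and> (\<exists>d<k. (i + d) mod p = t)}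
      = (\<lambda>d. (i + d) mod p) ` {d \<in> {..<k}. (i + d) mod n = c}"
    using assms by (auto simp: mod_mod_cancel)
  moreover have "{d \<in> {..<k}. (i + d) mod n = c} = (if offset n i c < k then {offset n i c} else {})"
  proof -
    have "d < k \<and> (i + d) mod n = c \<longleftrightarrow> d = offset n i c \<and> offset n i c < k" for d
      using assms(3) offset_eqI[of d n i c] add_offset_mod[OF assms(4), of i] by fastforce
    then show ?thesis by simp
  qed
  ultimately show ?thesis by auto
qed

text \<open>
  \<open>F i c\<close> is the number of vertices of class \<open>c\<close> in edge \<open>i\<close> other than links, and \<open>h i c\<close>
  the number of these lying in edge \<open>i + 1\<close> as well.
\<close>
lemma hamiltonian_cycle_from_fillers:
  fixes H :: "'a hypergraph" and F h :: "nat \<Rightarrow> nat \<Rightarrow> nat"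
  assumes H: "sigma_hypergraph n r q \<sigma> H"
    and k: "2 \<le> k" "k < n" and m: "0 < m"
    and pattern: "\<And>i. i < n * m \<Longrightarrow>
        filter_mset (\<lambda>m. m \<noteq> 0)
          (image_mset (\<lambda>c. of_bool (offset n i c < k) + F i c) (mset_set {..<n})) = \<sigma>"
    and share: "\<And>i c. i < n * m \<Longrightarrow> c < n \<Longrightarrow>
        h i c + h (Suc i mod (n * m)) c \<le> F (Suc i mod (n * m)) c"
    and total: "\<And>c. c < n \<Longrightarrow> m + (\<Sum>i<n * m. F i c) = q + (\<Sum>i<n * m. h i c)"
  shows "\<exists>C. intersecting_hamiltonian_cycle H k C"
proof -
  define p where "p = n * m"
  have np: "n dvd p" and "n \<le> p" using m by (auto simp: p_def)
  then have p3: "3 \<le> p" and kp: "k \<le> p" using k by linarith+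
  \<comment> \<open>The cyclic predecessor; adding \<open>p - 1\<close> avoids truncation at
    \<open>i = 0\<close>.\<close>
  define pr where "pr i = (i + (p - 1)) mod p" for i
  have pr_less: "pr i < p" for i using p3 by (simp add: pr_def)
  have Suc_pr: "Suc (pr i) mod p = i" if "i < p" for i
  proof -
    have "Suc (pr i) mod p = Suc (i + (p - 1)) mod p" by (simp add: pr_def mod_simps)
    also have "Suc (i + (p - 1)) = i + p" using p3 by simp
    finally show ?thesis using that by simp
  qed
  have pr_Suc: "pr (Suc i mod p) = i" if "i < p" for i
  proof -
    have "pr (Suc i mod p) = (Suc i + (p - 1)) mod p" by (simp add: pr_def mod_simps)
    also have "Suc i + (p - 1) = i + p" using p3 by simp
    finally show ?thesis using that by simp
  qed
  have Suc_neq: "Suc i mod p \<noteq> i" if "i < p" for i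
    using that p3 by (cases "Suc i = p") auto
  have pr_neq: "pr i \<noteq> i" if "i < p" for i
    using Suc_pr[OF that] Suc_neq[OF that] by metis
  have share': "h (pr i) c + h i c \<le> F i c" if "i < p" "c < n" for i c
    using share[of "pr i" c] pr_less[of i] Suc_pr that by (simp add: p_def)
  \<comment> \<open>Fillers not inherited from the preceding edge. By \<open>share'\<close> those
    passed on to the next edge can be chosen among them, so no filler lies in three edges.\<close>
  define g where "g i c = F i c - h (pr i) c" for i c
  have hg: "h i c \<le> g i c" and gF: "g i c + h (pr i) c = F i c" if "i < p" "c < n" for i c
    using share'[OF that] by (auto simp: g_def)
  \<comment> \<open>\<open>Inl t\<close> is the link of class \<open>t mod n\<close> in the edges \<open>t - (k - 1), \<dots>, t\<close>;
    \<open>Inr (i, c, j)\<close> is the \<open>j\<close>-th filler of class \<open>c\<close> that first occurs in edge \<open>i\<close>\<close>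
  define U :: "(nat + nat \<times> nat \<times> nat) set" where
    "U = Inl ` {..<p} \<union> Inr ` (SIGMA i:{..<p}. SIGMA c:{..<n}. {..<g i c})"
  define cl :: "nat + nat \<times> nat \<times> nat \<Rightarrow> nat" where
    "cl = case_sum (\<lambda>t. t mod n) (\<lambda>(i, c, j). c)"
  define J :: "nat + nat \<times> nat \<times> nat \<Rightarrow> nat set" where
    "J = case_sum (\<lambda>t. cyclic_window p k ((t + p - (k - 1)) mod p))
           (\<lambda>(i, c, j). if j < h i c then {i, Suc i mod p} else {i})"
  have sum_pr: "(\<Sum>i<p. h (pr i) c) = (\<Sum>i<p. h i c)" for c
    by (rule sum.reindex_bij_witness[where i = "\<lambda>i. Suc i mod p" and j = pr])
       (use p3 in \<open>auto simp: pr_less Suc_pr pr_Suc\<close>)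
  have sum_mod: "card {t \<in> {..<p}. t mod n = c} = m" if "c < n" for c
  proof -
    have "card {t \<in> {..<p}. t mod n = c} = (\<Sum>t<p. of_bool (t mod n = c))"
      by (simp add: of_bool_def sum.If_cases Int_def)
    also have "\<dots> = m * (\<Sum>t<n. of_bool (t mod n = c))"
      unfolding p_def by (rule sum_periodic) simp
    also have "(\<Sum>t<n. of_bool (t mod n = c)) = (\<Sum>t<n. if t = c then 1 else (0::nat))"
      by (rule sum.cong) auto
    also have "\<dots> = 1" using that by simp
    finally show ?thesis by simp
  qed
  show ?thesis
  proof (rule hamiltonian_cycle_from_incidence[OF H, of U cl J p k])
    show "finite U" by (auto simp: U_def)
    show "cl u < n" if "u \<in> U" for u
      using that k by (auto simp: U_def cl_def)
    show "card {u \<in> U. cl u = c} = q" if c: "c < n" for c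
    proof -
      have "{u \<in> U. cl u = c} = Inl ` {t \<in> {..<p}. t mod n = c} \<union>
          Inr ` (SIGMA i:{..<p}. {c} \<times> {..<g i c})"
        using c by (auto simp: U_def cl_def)
      moreover have "card \<dots> = card (Inl ` {t \<in> {..<p}. t mod n = c} :: (nat + nat \<times> nat \<times> nat) set) +
          card (Inr ` (SIGMA i:{..<p}. {c} \<times> {..<g i c}) :: (nat + nat \<times> nat \<times> nat) set)"
        by (rule card_Un_disjoint) auto
      moreover have "\<dots> = m + (\<Sum>i<p. g i c)"
        using sum_mod[OF c] by (simp add: card_image)
      moreover have "(\<Sum>i<p. g i c) + (\<Sum>i<p. h i c) = (\<Sum>i<p. F i c)"
        using gF c by (simp add: sum_pr[symmetric] sum.distrib[symmetric])
      ultimately show ?thesis using total[OF c] by (simp add: p_def)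
    qed
    show "J u \<noteq> {}" if "u \<in> U" for u
    proof -
      have "0 \<in> {..<k}" using k by simp
      then show ?thesis using that by (auto simp: U_def J_def cyclic_window_def split: if_splits)
    qed
    show "J u \<subseteq> {..<p}" if "u \<in> U" for u
    proof (cases u)
      case (Inl t)
      then show ?thesis using p3 by (simp add: J_def cyclic_window_subset)
    next
      case (Inr x)
      then show ?thesis using that p3 by (auto simp: U_def J_def split: if_splits)
    qed
    show "card (J u) < k \<or> (\<exists>i<p. J u = cyclic_window p k i)" if u: "u \<in> U" for u
    proof (cases u)
      case (Inl t)
      have "(t + p - (k - 1)) mod p < p" using p3 by simp
      then show ?thesis using Inl by (auto simp only: J_def sum.case)
    next
      case (Inr x)
      obtain i c j where x: "x = (i, c, j)" by (cases x) auto
      have i: "i < p" using u Inr x by (auto simp: U_def)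
      have "cyclic_window p 2 i = {i, Suc i mod p}"
        using i by (auto simp: cyclic_window_def numeral_2_eq_2 lessThan_Suc)
      moreover have "card {i, Suc i mod p} \<le> 2" by (simp add: card_insert_if)
      ultimately show ?thesis
        using Inr x k(1) i by (cases "k = 2") (auto simp: J_def)
    qed
    show "\<exists>u\<in>U. J u = cyclic_window p k i" if i: "i < p" for i
    proof (rule bexI)
      \<comment> \<open>A link is indexed by the last edge of its window, here \<open>k - 1\<close>
        steps after \<open>i\<close>.\<close>
      define t where "t = (i + (k - 1)) mod p"
      show "Inl t \<in> U" using p3 by (auto simp: U_def t_def)
      have "(t + p - (k - 1)) mod p = (t + (p - (k - 1))) mod p"
        using kp by simp
      also have "\<dots> = (i + (k - 1) + (p - (k - 1))) mod p"
        unfolding t_def by (rule mod_add_left_eq)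
      also have "\<dots> = i" using kp i by simp
      finally show "J (Inl t) = cyclic_window p k i" by (simp add: J_def)
    qed
    show "filter_mset (\<lambda>m. m \<noteq> 0)
       (image_mset (\<lambda>c. card {u \<in> U. cl u = c \<and> i \<in> J u}) (mset_set {..<n})) = \<sigma>"
      if i: "i < p" for i
    proof -
      have "card {u \<in> U. cl u = c \<and> i \<in> J u} = of_bool (offset n i c < k) + F i c"
        if c: "c < n" for c
      proof -
        let ?L = "Inl ` {t \<in> {..<p}. t mod n = c \<and> (\<exists>d<k. (i + d) mod p = t)}
          :: (nat + nat \<times> nat \<times> nat) set"
        \<comment> \<open>\<open>?A\<close> holds the fillers that first occur in edge
          \<open>i\<close>, \<open>?B\<close> those inherited from edge \<open>pr i\<close>.\<close>
        let ?A = "{i} \<times> {c} \<times> {..<g i c}" and ?B = "{pr i} \<times> {c} \<times> {..<h (pr i) c}"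
        have link: "Inl t \<in> {u \<in> U. cl u = c \<and> i \<in> J u} \<longleftrightarrow> Inl t \<in> ?L" for t
          using cyclic_window_mem_iff[OF i, of t k] kp k by (auto simp: U_def cl_def J_def)
        have filler: "Inr (i', c', j) \<in> {u \<in> U. cl u = c \<and> i \<in> J u} \<longleftrightarrow> (i', c', j) \<in> ?A \<union> ?B"
          for i' c' j
          using i c hg[of "pr i" c] pr_less[of i] Suc_pr[OF i] pr_Suc[of i'] hg[of i c]
          by (auto simp: U_def cl_def J_def split: if_splits)
        have "u \<in> {u \<in> U. cl u = c \<and> i \<in> J u} \<longleftrightarrow> u \<in> ?L \<union> Inr ` (?A \<union> ?B)" for u
        proof (cases u)
          case (Inl t)
          then show ?thesis using link[of t] by blast
        next
          case (Inr x)
          obtain i' c' j where "x = (i', c', j)" by (cases x) auto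
          then show ?thesis using Inr filler[of i' c' j] by auto
        qed
        then have "{u \<in> U. cl u = c \<and> i \<in> J u} = ?L \<union> Inr ` (?A \<union> ?B)" by blast
        moreover have "card (?L \<union> Inr ` (?A \<union> ?B)) = card ?L + card (?A \<union> ?B)"
          by (subst card_Un_disjoint) (auto simp: card_image)
        moreover have "card (?A \<union> ?B) = g i c + h (pr i) c"
          using pr_neq[OF i] by (subst card_Un_disjoint) auto
        moreover have "card ?L = of_bool (offset n i c < k)"
          using card_links[OF np _ _ c, of k i] p3 k by (simp add: card_image)
        ultimately show ?thesis using gF[OF i c] by simp
      qed
      then have "image_mset (\<lambda>c. card {u \<in> U. cl u = c \<and> i \<in> J u}) (mset_set {..<n})
          = image_mset (\<lambda>c. of_bool (offset n i c < k) + F i c) (mset_set {..<n})"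
        by (intro image_mset_cong) simp
      then show ?thesis using pattern[of i] i by (simp add: p_def)
    qed
    show "0 < k" "k \<le> p" using k kp by auto
  qed
qed

section \<open>Edges obtained by rotating a fixed list\<close>

lemma sum_offset_periods: "c < n \<Longrightarrow> (\<Sum>i<n * m. G (offset n i c)) = m * (\<Sum>d<n. G d)" for G :: "nat \<Rightarrow> nat"
  by (subst sum_periodic) (simp_all add: offset_periodic sum_offset_position)

lemma offset_mod: "n dvd p \<Longrightarrow> offset n (i mod p) c = offset n i c"
  by (simp add: offset_def mod_mod_cancel)

lemma offset_Suc:
  assumes "c < n"
  shows "offset n (Suc i) c = (if offset n i c = 0 then n - 1 else offset n i c - 1)"
proof (rule offset_eqI)
  show "(if offset n i c = 0 then n - 1 else offset n i c - 1) < n"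
    using assms offset_less[of n i c] by auto
  show "(Suc i + (if offset n i c = 0 then n - 1 else offset n i c - 1)) mod n = c"
    using assms add_offset_mod[OF assms, of i] by auto
qed

lemma image_mset_nth: "image_mset ((!) xs) (mset_set {..<length xs}) = mset xs"
proof -
  have "image_mset ((!) xs) (mset [0..<length xs]) = mset xs"
    by (metis map_nth mset_map)
  then show ?thesis by (simp add: lessThan_atLeast0)
qed

lemma sum_nth: "(\<Sum>d<length xs. xs ! d) = sum_mset (mset xs)"
  by (simp add: sum_mset_sum_list sum_list_sum_nth lessThan_atLeast0)

text \<open>Counts the fillers of an edge: each of the first \<open>k\<close> positions gives up one
  vertex to a link, and positivity keeps the subtraction exact.\<close>

lemma sum_nth_diff_of_bool:
  fixes xs :: "nat list"
  assumes "k \<le> length xs" "\<And>d. d < k \<Longrightarrow> 0 < xs ! d"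
  shows "(\<Sum>d<length xs. xs ! d - of_bool (d < k)) = sum_mset (mset xs) - k"
proof -
  have "{..<length xs} \<inter> {d. d < k} = {..<k}" using assms(1) by auto
  then have "(\<Sum>d<length xs. of_bool (d < k)) = k"
    by (simp add: of_bool_def sum.If_cases)
  moreover have "(\<Sum>d<length xs. xs ! d - of_bool (d < k)) + (\<Sum>d<length xs. of_bool (d < k))
      = (\<Sum>d<length xs. xs ! d)"
    unfolding sum.distrib[symmetric] using assms(2) by (intro sum.cong) (auto simp: Suc_leI)
  ultimately show ?thesis by (simp add: sum_nth)
qed

lemma sigma_hypergraph_sum: "sigma_hypergraph n r q \<sigma> H \<Longrightarrow> sum_mset \<sigma> = r"
  by (simp add: sigma_hypergraph_def partition_of_def)

text \<open>
  Edge \<open>i\<close> takes \<open>xs ! d\<close> vertices from class \<open>i + d\<close>. Class \<open>i + 1\<close> has a filler in both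
  edges \<open>i\<close> and \<open>i + 1\<close>; identifying the two for all \<open>i < n * D\<close> saves \<open>D\<close> vertices per class.
\<close>
lemma hamiltonian_cycle_rotation:
  fixes H :: "'a hypergraph"
  assumes H: "sigma_hypergraph n r q \<sigma> H"
    and k: "2 \<le> k" "k < n" and m: "0 < m" "D \<le> m"
    and xs: "length xs = n" "filter_mset (\<lambda>m. m \<noteq> 0) (mset xs) = \<sigma>" "\<And>d. d < k \<Longrightarrow> 0 < xs ! d"
    and big: "D = 0 \<or> 2 \<le> xs ! 0 \<and> 2 \<le> xs ! 1"
    and total: "m * (r - k + 1) = q + D"
  shows "\<exists>C. intersecting_hamiltonian_cycle H k C"
proof -
  define f where "f d = xs ! d - of_bool (d < k)" for d
  have sumf: "(\<Sum>d<n. f d) = r - k"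
    using sum_nth_diff_of_bool[of k xs] k xs sigma_hypergraph_sum[OF H]
    by (simp add: f_def sum_mset_filter_nonzero[of "mset xs", symmetric])
  show ?thesis
  proof (rule hamiltonian_cycle_from_fillers[OF H k m(1), where F = "\<lambda>i c. f (offset n i c)"
        and h = "\<lambda>i c. of_bool (i < n * D \<and> offset n i c = 1)"])
    fix i
    have "image_mset (\<lambda>c. of_bool (offset n i c < k) + f (offset n i c)) (mset_set {..<n})
        = image_mset (\<lambda>d. of_bool (d < k) + f d) (mset_set {..<n})"
      using image_mset_offset_class[of n "\<lambda>d. of_bool (d < k) + f d" i] k by simp
    also have "\<dots> = image_mset ((!) xs) (mset_set {..<n})"
      using xs(3) by (intro image_mset_cong) (auto simp: f_def Suc_leI)
    also have "\<dots> = mset xs" using image_mset_nth[of xs] xs(1) by simp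
    finally show "filter_mset (\<lambda>m. m \<noteq> 0)
        (image_mset (\<lambda>c. of_bool (offset n i c < k) + f (offset n i c)) (mset_set {..<n})) = \<sigma>"
      using xs(2) by simp
  next
    fix i c assume "i < n * m" and c: "c < n"
    have o: "offset n (Suc i mod (n * m)) c = offset n (Suc i) c" by (simp add: offset_mod)
    show "of_bool (i < n * D \<and> offset n i c = 1)
        + of_bool (Suc i mod (n * m) < n * D \<and> offset n (Suc i mod (n * m)) c = 1)
        \<le> f (offset n (Suc i mod (n * m)) c)"
    proof (cases "D = 0")
      case False
      \<comment> \<open>An edge passes a filler on at offset 1, and the next edge receives it at
        offset 0. These offsets differ, so one filler at each suffices.\<close>
      then have "1 \<le> f 0" "1 \<le> f 1" using big k by (auto simp: f_def)
      then show ?thesis unfolding o by (auto simp: offset_Suc[OF c])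
    qed simp
  next
    fix c assume c: "c < n"
    \<comment> \<open>The positions below \<open>n * D\<close> form \<open>D\<close> full rotations,
      and a class has offset 1 once in each.\<close>
    have "(\<Sum>i<n * m. of_bool (i < n * D \<and> offset n i c = 1)) = (\<Sum>i<n * D. of_bool (offset n i c = 1))"
      using m(2) by (intro sum.mono_neutral_cong_right) (auto intro: less_le_trans)
    also have "\<dots> = D * (\<Sum>d<n. of_bool (d = 1))"
      by (rule sum_offset_periods[OF c])
    also have "(\<Sum>d<n. of_bool (d = 1)) = (1::nat)" using k by (simp add: of_bool_def)
    finally show "m + (\<Sum>i<n * m. f (offset n i c))
        = q + (\<Sum>i<n * m. of_bool (i < n * D \<and> offset n i c = 1))"
      using total unfolding sum_offset_periods[OF c] sumf by simp
  qed
qed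

section \<open>Sharing fillers within disjoint pairs of edges\<close>

text \<open>Used to select \<open>D\<close> of the \<open>r - k\<close> fillers of an edge for
  sharing; \<open>g\<close> records how many come from each offset.\<close>

lemma exists_le_with_sum:
  fixes f :: "nat \<Rightarrow> nat"
  assumes "D \<le> (\<Sum>d<n. f d)"
  shows "\<exists>g. (\<forall>d. g d \<le> f d) \<and> (\<Sum>d<n. g d) = D"
  using assms
proof (induction D)
  case 0
  then show ?case by (intro exI[of _ "\<lambda>_. 0"]) simp
next
  case (Suc D)
  then obtain g where g: "\<And>d. g d \<le> f d" "(\<Sum>d<n. g d) = D" by auto
  have "\<exists>d<n. g d < f d"
  proof (rule ccontr)
    assume "\<not> ?thesis"
    then have "(\<Sum>d<n. f d) \<le> (\<Sum>d<n. g d)" by (intro sum_mono) auto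
    then show False using Suc.prems g(2) by simp
  qed
  then obtain a where a: "a < n" "g a < f a" by blast
  have "(\<Sum>d<n. (g(a := Suc (g a))) d) = Suc (g a) + (\<Sum>d\<in>{..<n} - {a}. g d)"
    using a by (subst sum.remove[of _ a]) auto
  also have "\<dots> = Suc D" using a g(2) sum.remove[of "{..<n}" a g] by simp
  finally show ?case using g a by (intro exI[of _ "g(a := Suc (g a))"]) auto
qed

text \<open>
  The positions \<open>spread n i\<close> for \<open>i < n\<close> represent every residue modulo \<open>n\<close> once, and no two of
  them are consecutive.
\<close>
definition spread :: "nat \<Rightarrow> nat \<Rightarrow> nat" where
  "spread n i = (if even i then i else n + i)"

lemma spread_inj: "inj_on (spread n) {..<n}"
  by (auto simp: inj_on_def spread_def split: if_splits)

text \<open>The even values are at most \<open>n - 1\<close> and the shifted odd ones at least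
  \<open>n + 1\<close>; within either block all differences are even.\<close>

lemma spread_not_adjacent:
  assumes "i < n" "j < n"
  shows "spread n i \<noteq> Suc (spread n j)"
  using assms unfolding spread_def by (cases "even i"; cases "even j") (auto, presburger+)

lemma sum_spread:
  assumes "\<And>i. f (i + n) = f i"
  shows "(\<Sum>i\<in>spread n ` {..<n}. f i) = (\<Sum>i<n. f i)"
proof -
  have "f (spread n i) = f i" for i
    using assms[of i] by (simp add: spread_def add.commute)
  then show ?thesis by (simp add: sum.reindex[OF spread_inj])
qed

text \<open>
  The link classes of edges \<open>i\<close> and \<open>i + 1\<close> differ only in that \<open>i\<close> is replaced by \<open>i + k\<close>, and
  neither of these holds fillers of edge \<open>i\<close>. Hence edge \<open>i + 1\<close> may take its fillers from the same
  classes as edge \<open>i\<close>, which allows any \<open>D \<le> r - k\<close> of them to be shared. Doing so once for each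
  residue of \<open>i\<close> modulo \<open>n\<close> saves \<open>D\<close> vertices in every class.
\<close>
lemma hamiltonian_cycle_paired:
  fixes H :: "'a hypergraph"
  assumes H: "sigma_hypergraph n r q \<sigma> H"
    and k: "2 \<le> k" "k < n" and m: "3 \<le> m" and D: "D \<le> r - k"
    and xs: "length xs = n" "filter_mset (\<lambda>m. m \<noteq> 0) (mset xs) = \<sigma>" "\<And>d. d < k \<Longrightarrow> 0 < xs ! d"
    and swap: "xs ! 0 = 1" "xs ! k = 0"
    and total: "m * (r - k + 1) = q + D"
  shows "\<exists>C. intersecting_hamiltonian_cycle H k C"
proof -
  define f where "f d = xs ! d - of_bool (d < k)" for d
  have sumf: "(\<Sum>d<n. f d) = r - k"
    using sum_nth_diff_of_bool[of k xs] k xs sigma_hypergraph_sum[OF H]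
    by (simp add: f_def sum_mset_filter_nonzero[of "mset xs", symmetric])
  obtain g where g: "\<And>d. g d \<le> f d" "(\<Sum>d<n. g d) = D"
    using exists_le_with_sum[of D f n] D sumf by auto
  define S where "S = spread n ` {..<n}"
  have adj: "Suc i \<notin> S" if "i \<in> S" for i
    using that spread_not_adjacent unfolding S_def by (metis imageE lessThan_iff)
  have S_less: "Suc i < n * m" if "i \<in> S" for i
  proof -
    \<comment> \<open>\<open>S\<close> lies in the first two periods, so with a third one no pair
      wraps around.\<close>
    have "i < 2 * n" using that by (auto simp: S_def spread_def)
    then have "Suc i < n * 3" using k by linarith
    also have "\<dots> \<le> n * m" using m by (intro mult_left_mono) auto
    finally show ?thesis .
  qed
  \<comment> \<open>The edge from which edge \<open>i\<close> takes its filler classes: its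
    predecessor if \<open>i\<close> is the second edge of a pair, otherwise \<open>i\<close>
    itself.\<close>
  define u where "u i = (if i \<in> Suc ` S then i - 1 else i)" for i
  show ?thesis
  proof (rule hamiltonian_cycle_from_fillers[OF H k, where m = m and F = "\<lambda>i c. f (offset n (u i) c)"
        and h = "\<lambda>i c. if i \<in> S then g (offset n i c) else 0"])
    show "0 < m" using m by simp
  next
    fix i
    have "\<exists>ys. mset ys = mset xs \<and>
      image_mset (\<lambda>c. of_bool (offset n i c < k) + f (offset n (u i) c)) (mset_set {..<n}) = mset ys"
    proof (cases "i \<in> Suc ` S")
      case False
      then have "image_mset (\<lambda>c. of_bool (offset n i c < k) + f (offset n (u i) c)) (mset_set {..<n})
          = image_mset (\<lambda>d. of_bool (d < k) + f d) (mset_set {..<n})"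
        using image_mset_offset_class[of n "\<lambda>d. of_bool (d < k) + f d" i] k by (simp add: u_def)
      also have "\<dots> = image_mset ((!) xs) (mset_set {..<n})"
        using xs(3) by (intro image_mset_cong) (auto simp: f_def Suc_leI)
      also have "\<dots> = mset xs" using image_mset_nth[of xs] xs(1) by simp
      finally show ?thesis by blast
    next
      case True
      then obtain j where j: "i = Suc j" by blast
      then have u: "u i = j" using True by (simp add: u_def)
      \<comment> \<open>The profile of edge \<open>j + 1\<close> in offsets relative to
        \<open>j\<close>: the part 1 moves from offset 0 to the empty offset \<open>k\<close>, all
        else is unchanged.\<close>
      define ys where "ys = xs[k := xs ! 0, 0 := xs ! k]"
      have "image_mset (\<lambda>c. of_bool (offset n i c < k) + f (offset n (u i) c)) (mset_set {..<n})
          = image_mset (\<lambda>c. ys ! offset n j c) (mset_set {..<n})"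
      proof (rule image_mset_cong)
        fix c assume "c \<in># mset_set {..<n}"
        then have c: "c < n" by simp
        define d where "d = offset n j c"
        have d: "d < n" using offset_less[of n j c] c by (simp add: d_def)
        have "ys ! d = (if d = 0 then 0 else if d = k then 1 else xs ! d)"
          using k xs(1) swap d by (auto simp: ys_def nth_list_update)
        \<comment> \<open>Offset 0 wraps to \<open>n - 1\<close>, which is at least
          \<open>k\<close>.\<close>
        moreover have "offset n i c < k \<longleftrightarrow> 0 < d \<and> d \<le> k"
          using offset_Suc[OF c, of j] k by (auto simp: j d_def)
        moreover have "f 0 = 0" "f k = 0" using swap k by (auto simp: f_def)
        moreover have "f d = xs ! d - of_bool (d < k)" "d < k \<Longrightarrow> 0 < xs ! d"
          using xs(3) by (auto simp: f_def)
        ultimately show "of_bool (offset n i c < k) + f (offset n (u i) c) = ys ! offset n j c"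
          unfolding u d_def[symmetric] by auto
      qed
      also have "\<dots> = image_mset ((!) ys) (mset_set {..<n})"
        using image_mset_offset_class[of n "(!) ys" j] k by simp
      also have "\<dots> = mset ys" using image_mset_nth[of ys] xs(1) by (simp add: ys_def)
      finally show ?thesis
        using mset_swap[of 0 xs k] k xs(1) by (auto simp: ys_def)
    qed
    then show "filter_mset (\<lambda>m. m \<noteq> 0)
        (image_mset (\<lambda>c. of_bool (offset n i c < k) + f (offset n (u i) c)) (mset_set {..<n})) = \<sigma>"
      using xs(2) by metis
  next
    fix i c assume i: "i < n * m" and c: "c < n"
    let ?i' = "Suc i mod (n * m)"
    \<comment> \<open>At most one summand is nonzero by \<open>adj\<close>. Within a pair both edges
      have the filler profile of \<open>i\<close>, which bounds \<open>g\<close>; otherwise edge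
      \<open>?i'\<close> has its own profile.\<close>
    show "(if i \<in> S then g (offset n i c) else 0) + (if ?i' \<in> S then g (offset n ?i' c) else 0)
        \<le> f (offset n (u ?i') c)"
    proof (cases "i \<in> S")
      case True
      then have "?i' = Suc i" using S_less by simp
      then show ?thesis using True adj g(1) by (simp add: u_def)
    next
      case False
      have "?i' \<notin> Suc ` S" 
      proof
        assume "?i' \<in> Suc ` S"
        then obtain j where j: "j \<in> S" "?i' = Suc j" by blast
        then have "i = j" using i by (cases "Suc i = n * m") auto
        then show False using j False by simp
      qed
      then show ?thesis using False g(1) by (simp add: u_def)
    qed
  next
    fix c assume c: "c < n"
    define \<phi> where "\<phi> i = f (offset n i c)" for i
    have \<phi>per: "\<phi> (i + n) = \<phi> i" for i by (simp add: \<phi>_def offset_periodic)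
    have SS: "Suc ` S \<subseteq> {..<n * m}" and S: "S \<subseteq> {..<n * m}" using S_less by fastforce+
    have "(\<Sum>i<n * m. \<phi> (u i)) = (\<Sum>i\<in>{..<n * m} - Suc ` S. \<phi> (u i)) + (\<Sum>i\<in>Suc ` S. \<phi> (u i))"
      using SS by (intro sum.subset_diff) auto
    also have "(\<Sum>i\<in>{..<n * m} - Suc ` S. \<phi> (u i)) = (\<Sum>i\<in>{..<n * m} - Suc ` S. \<phi> i)"
      by (rule sum.cong) (auto simp: u_def)
    also have "(\<Sum>i\<in>Suc ` S. \<phi> (u i)) = (\<Sum>i\<in>S. \<phi> i)"
      by (simp add: sum.reindex u_def)
    also have "(\<Sum>i\<in>S. \<phi> i) = (\<Sum>i<n. \<phi> i)"
      unfolding S_def by (rule sum_spread[of \<phi>, OF \<phi>per])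
    also have "\<dots> = (\<Sum>i<n. \<phi> (Suc i))"
      using sum.lessThan_Suc_shift[of \<phi> n] \<phi>per[of 0] by simp
    also have "\<dots> = (\<Sum>i\<in>S. \<phi> (Suc i))"
      unfolding S_def using \<phi>per by (intro sum_spread[symmetric]) (metis add_Suc)
    also have "\<dots> = (\<Sum>i\<in>Suc ` S. \<phi> i)"
      by (simp add: sum.reindex)
    also have "(\<Sum>i\<in>{..<n * m} - Suc ` S. \<phi> i) + (\<Sum>i\<in>Suc ` S. \<phi> i) = (\<Sum>i<n * m. \<phi> i)"
      using SS by (intro sum.subset_diff[symmetric]) auto
    also have "\<dots> = m * (r - k)"
      unfolding \<phi>_def sumf[symmetric] by (rule sum_offset_periods[OF c])
    finally have F: "(\<Sum>i<n * m. f (offset n (u i) c)) = m * (r - k)" by (simp add: \<phi>_def)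
    have "(\<Sum>i<n * m. if i \<in> S then g (offset n i c) else 0) = (\<Sum>i\<in>S. g (offset n i c))"
      using S by (simp add: sum.If_cases Int_absorb1)
    also have "\<dots> = (\<Sum>i<n. g (offset n i c))"
      unfolding S_def by (rule sum_spread) (simp add: offset_periodic)
    also have "\<dots> = D" using g(2) sum_offset_position[OF c, of g] by simp
    finally show "m + (\<Sum>i<n * m. f (offset n (u i) c))
        = q + (\<Sum>i<n * m. if i \<in> S then g (offset n i c) else 0)"
      using F total by simp
  qed
qed

section \<open>Choice of the parameters and of the list of parts\<close>

theorem theorem4p3:
  fixes H :: "'a hypergraph" and n r q k :: nat and \<sigma> :: "nat multiset"
  assumes "sigma_hypergraph n r q \<sigma> H"
    and "2 \<le> size \<sigma>"
    and "2 \<le> k" and "k \<le> size \<sigma>"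
    and "r * (r - 1) \<le> q"
    and "size \<sigma> + 1 \<le> n"
  shows "\<exists>C. intersecting_hamiltonian_cycle H k C"
proof -
  note H = assms(1)
  have pos: "\<And>a. a \<in># \<sigma> \<Longrightarrow> 0 < a" and sum: "sum_mset \<sigma> = r"
    using H by (auto simp: sigma_hypergraph_def partition_of_def)
  have fin: "filter_mset (\<lambda>m. m \<noteq> 0) \<sigma> = \<sigma>"
    using pos by (auto simp: filter_mset_eq_conv)
  have size_le: "size M \<le> sum_mset M" if "\<And>a. a \<in># M \<Longrightarrow> 0 < a" for M :: "nat multiset"
    using that by (induction M) (auto, fastforce)
  have kr: "k \<le> r" using size_le[of \<sigma>] pos sum assms(4) by simp
  have kn: "k < n" using assms by simp
  define v where "v = r - k + 1"
  \<comment> \<open>Since \<open>r - k = v - 1\<close>, this is \<open>q / v\<close> rounded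
    up.\<close>
  define m where "m = (q + (r - k)) div v"
  define D where "D = m * v - q"
  have eq: "m * v + (q + (r - k)) mod v = q + (r - k)" unfolding m_def by (rule div_mult_mod_eq)
  have "(q + (r - k)) mod v < r - k + 1" unfolding v_def by (rule mod_less_divisor) simp
  then have mv: "q \<le> m * v" "m * v \<le> q + (r - k)" using eq by linarith+
  then have D: "m * v = q + D" "D \<le> r - k" unfolding D_def by linarith+
  \<comment> \<open>\<open>k \<ge> 2\<close> gives \<open>v \<le> r - 1\<close>, whence
    \<open>r * v \<le> q \<le> m * v\<close>.\<close>
  have "r * v \<le> r * (r - 1)" using kr assms(3) by (intro mult_left_mono) (auto simp: v_def)
  then have "r * v \<le> m * v" using mv(1) assms(5) by linarith
  moreover have "0 < v" by (simp add: v_def)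
  ultimately have rm: "r \<le> m" by simp
  \<comment> \<open>Pairing is used only if sharing is required and a part 1 exists; otherwise
    \<open>D = 0\<close> or all parts are at least 2, and rotation works.\<close>
  show ?thesis
  proof (cases "0 < D \<and> 1 \<in># \<sigma>")
    case True
    then obtain \<tau> where \<tau>: "\<sigma> = add_mset 1 \<tau>" by (meson mset_add)
    obtain ys where ys: "mset ys = \<tau>" using ex_mset by blast
    have len: "length ys + 1 = size \<sigma>" using ys \<tau> by (metis Suc_eq_plus1 size_add_mset size_mset)
    define xs where "xs = (1 # take (k - 1) ys) @ 0 # drop (k - 1) ys @ replicate (n - size \<sigma> - 1) 0"
    have take: "length (take (k - 1) ys) = k - 1" using len assms(4) by simp
    show ?thesis
    proof (rule hamiltonian_cycle_paired[OF H assms(3) kn _ D(2), of m xs])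
      \<comment> \<open>\<open>0 < D \<le> r - k\<close> forces \<open>r > k \<ge> 2\<close>, and
        \<open>r \<le> m\<close>.\<close>
      show "3 \<le> m" using True D(2) rm assms(3) by linarith
      show "length xs = n" using len assms by (simp add: xs_def)
      have "mset xs = add_mset 1 (mset (take (k - 1) ys @ drop (k - 1) ys)) + replicate_mset (n - size \<sigma>) 0"
        using assms(6) unfolding xs_def by (cases "n - size \<sigma>") (auto simp del: append_take_drop_id)
      then have "mset xs = \<sigma> + replicate_mset (n - size \<sigma>) 0"
        using ys \<tau> by simp
      then show "filter_mset (\<lambda>m. m \<noteq> 0) (mset xs) = \<sigma>" using fin by simp
      show "xs ! 0 = 1" by (simp add: xs_def)
      show "xs ! k = 0" using take assms(3) by (simp add: xs_def nth_append)
      show "0 < xs ! d" if "d < k" for d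
      proof -
        have l: "d < length (1 # take (k - 1) ys)" using that take by simp
        then have "xs ! d = (1 # take (k - 1) ys) ! d" by (simp only: xs_def nth_append if_True)
        moreover have "\<dots> \<in> set (1 # take (k - 1) ys)" using l by (rule nth_mem)
        moreover have "set (1 # take (k - 1) ys) \<subseteq> set_mset \<sigma>"
          using \<tau> ys set_take_subset[of "k - 1" ys] by auto
        ultimately show ?thesis using pos by (metis subsetD)
      qed
      show "m * (r - k + 1) = q + D" using D(1) by (simp add: v_def)
    qed
  next
    case False
    obtain ys where ys: "mset ys = \<sigma>" using ex_mset by blast
    then have len: "length ys = size \<sigma>" by auto
    define xs where "xs = ys @ replicate (n - size \<sigma>) 0"
    have nth: "xs ! d \<in># \<sigma>" if "d < k" for d
      using that len assms(4) ys nth_mem[of d ys] by (auto simp: xs_def nth_append)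
    show ?thesis
    proof (rule hamiltonian_cycle_rotation[OF H assms(3) kn, of m D xs])
      show "0 < m" "D \<le> m" using rm D(2) kr assms(3) by linarith+
      show "length xs = n" using len assms by (simp add: xs_def)
      show "filter_mset (\<lambda>m. m \<noteq> 0) (mset xs) = \<sigma>" using ys fin by (simp add: xs_def)
      show "0 < xs ! d" if "d < k" for d using nth[OF that] pos by simp
      have "2 \<le> xs ! d" if "1 \<notin># \<sigma>" "d < k" for d
        using nth[OF that(2)] pos[of "xs ! d"] that(1) by (cases "xs ! d = 1") auto
      then show "D = 0 \<or> 2 \<le> xs ! 0 \<and> 2 \<le> xs ! 1" using False assms(3) by auto
      show "m * (r - k + 1) = q + D" using D(1) by (simp add: v_def)
    qed
  qed
qed

end
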